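(* Let $\mu\in\mathbb{R}$, $\sigma>0$, and let $\phi$ be the (analytically continued) Laplace transform of $X\sim\mathrm{LN}(\mu,\sigma^2)$. For $\alpha\ge 1$ and $z\in\mathbb{C}\setminus(-\infty,0]$ put $$S_\alpha(z)=\sum_{n=0}^\infty \frac{(-z)^n}{n!}\,e^{\mu n+\frac{\sigma^2}{2}n^2}\cdot\frac12\operatorname{erfc}\left(\frac{\mu+\ln(z/\alpha)+\sigma^2 n}{\sqrt2\,\sigma}\right).$$ Then this series converges for every $\alpha\ge1$ and $z\in\mathbb{C}\setminus(-\infty,0]$, and $$\phi(z)=S_\alpha(z)+O(e^{-\alpha}),\qquad z\in\mathbb{C}\setminus(-\infty,0],$$ where the implied constant may depend on $\mu,\sigma$ but not on $z\in\mathbb{C}\setminus(-\infty,0]$ or $\alpha\ge 1$. Furthermore, for each $\alpha\ge1$, $$\phi(z)\sim S_\alpha(z)\quad\text{as } z\to 0,\ z\in\mathbb{C}\setminus(-\infty,0].$$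
   Context: $X\sim\mathrm{LN}(\mu,\sigma^2)$ (lognormal, $\mu\in\mathbb{R}$, $\sigma>0$) means that $X$ is a positive random variable with density $f(x)=\frac{1}{\sqrt{2\pi}\,\sigma x}\exp\left[-\frac{(\ln x-\mu)^2}{2\sigma^2}\right]$, $x>0$. Its Laplace transform is $\phi(z)=\mathbb{E}[e^{-zX}]$ for $\operatorname{Re}(z)\ge 0$, and $\phi$ also denotes the (unique) analytic continuation of this function from $\{\operatorname{Re}(z)>0\}$ to $\mathbb{C}\setminus(-\infty,0]$. Explicitly, for $z\in\mathbb{C}\setminus(-\infty,0]$, the continuation is $\phi(z)=(2\pi\sigma^2)^{-1/2}e^{-(\mu+\ln z)^2/(2\sigma^2)}\int_0^\infty \frac1x\exp\left[-x-\frac{(\ln x)^2}{2\sigma^2}+\frac{(\mu+\ln z)\ln x}{\sigma^2}\right]dx$. $\ln$ denotes the principal branch of the complex logarithm. $\operatorname{erfc}$ is the complementary error function, extended to an entire function: $\operatorname{erfc}(u)=1-\frac{2}{\sqrt\pi}\int_0^u e^{-v^2}dv$. The notation $g(z)\sim h(z)$ as $z\to0$ means $g(z)/h(z)\to1$. *)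

theory Defs
  imports "HOL-Probability.Probability" "HOL-Complex_Analysis.Complex_Analysis"
begin

definition lognormal_density :: "real \<Rightarrow> real \<Rightarrow> real \<Rightarrow> real" where
  "lognormal_density \<mu> \<sigma> x =
     (if x > 0 then 1 / (sqrt (2 * pi) * \<sigma> * x) * exp (- ((ln x - \<mu>)\<^sup>2) / (2 * \<sigma>\<^sup>2)) else 0)"

definition lognormal :: "real \<Rightarrow> real \<Rightarrow> real measure" where
  "lognormal \<mu> \<sigma> = density lborel (\<lambda>x. ennreal (lognormal_density \<mu> \<sigma> x))"

definition laplace_transform :: "real measure \<Rightarrow> complex \<Rightarrow> complex" where
  "laplace_transform N z = (\<integral>x. exp (- (z * complex_of_real x)) \<partial>N)"

text \<open>The transform of the law is the expectation over any random variable with that law.\<close>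

lemma laplace_transform_lognormal_eq_expectation:
  assumes "distributed M lborel X (\<lambda>x. ennreal (lognormal_density \<mu> \<sigma> x))"
  shows "laplace_transform (lognormal \<mu> \<sigma>) z = (\<integral>\<omega>. exp (- (z * complex_of_real (X \<omega>))) \<partial>M)"
proof -
  have law: "distr M lborel X = lognormal \<mu> \<sigma>"
    using assms by (simp add: distributed_distr_eq_density lognormal_def)
  show ?thesis
    unfolding laplace_transform_def law[symmetric]
    by (rule integral_distr) (use assms in \<open>auto simp: distributed_def\<close>)
qed

text \<open>
  By the identity theorem any two choices of \<open>f\<close> agree on the slit plane; values on
  \<open>\<real>\<^sub>\<le>\<^sub>0\<close> are unspecified.
\<close>

definition lognormal_phi :: "real \<Rightarrow> real \<Rightarrow> complex \<Rightarrow> complex" where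
  "lognormal_phi \<mu> \<sigma> =
     (SOME f. f holomorphic_on (- \<real>\<^sub>\<le>\<^sub>0) \<and>
              (\<forall>z. Re z > 0 \<longrightarrow> f z = laplace_transform (lognormal \<mu> \<sigma>) z))"

text \<open>The integrand is entire, so the straight path from \<open>0\<close> to \<open>u\<close> is no restriction.\<close>

definition erfc :: "complex \<Rightarrow> complex" where
  "erfc u = 1 - 2 / complex_of_real (sqrt pi) * contour_integral (linepath 0 u) (\<lambda>v. exp (- (v\<^sup>2)))"

definition S_term :: "real \<Rightarrow> real \<Rightarrow> real \<Rightarrow> complex \<Rightarrow> nat \<Rightarrow> complex" where
  "S_term \<mu> \<sigma> \<alpha> z n =
     (- z) ^ n / fact n * complex_of_real (exp (\<mu> * real n + \<sigma>\<^sup>2 / 2 * (real n)\<^sup>2)) *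
     (1 / 2 * erfc ((complex_of_real \<mu> + Ln (z / complex_of_real \<alpha>) + complex_of_real (\<sigma>\<^sup>2 * real n))
                    / complex_of_real (sqrt 2 * \<sigma>)))"

definition S :: "real \<Rightarrow> real \<Rightarrow> real \<Rightarrow> complex \<Rightarrow> complex" where
  "S \<mu> \<sigma> \<alpha> z = (\<Sum>n. S_term \<mu> \<sigma> \<alpha> z n)"

end

theory Submission
  imports Defs
begin

text \<open>
  Put \<open>w = \<mu> + ln z\<close>. Substituting \<open>x = e\<^sup>t / z\<close> gives
  \<open>\<phi>(z) = (2\<pi>\<sigma>\<^sup>2)^(-1/2) \<integral> exp (-e\<^sup>t) exp (-(t - w)\<^sup>2 / (2\<sigma>\<^sup>2)) dt\<close>, first for \<open>z > 0\<close> and then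
  on the slit plane by analytic continuation. Cut the integral at \<open>t = ln \<alpha>\<close>. Below the cut, expand
  \<open>exp (-e\<^sup>t)\<close> in powers of \<open>e\<^sup>t \<le> \<alpha>\<close>; completing the square turns the \<open>n\<close>-th summand into a
  Gaussian tail, so that the sum is \<open>S\<^sub>\<alpha>(z)\<close>. Above the cut, \<open>exp (-e\<^sup>t) \<le> e\<^sup>-\<^sup>\<alpha>\<close> while the modulus of the normalized kernel has
  total mass \<open>exp ((Im w)\<^sup>2 / (2\<sigma>\<^sup>2)) \<le> exp (\<pi>\<^sup>2 / (2\<sigma>\<^sup>2))\<close>. As \<open>z \<rightarrow> 0\<close> both \<open>\<phi>(z) - 1\<close> and the
  part above the cut are \<open>O(|z|)\<close>, since \<open>1 - exp (-e\<^sup>t)\<close> and (for \<open>t \<ge> 0\<close>) \<open>exp (-e\<^sup>t)\<close> are at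
  most \<open>e\<^sup>t\<close>.
\<close>

subsection \<open>Holomorphic parameter integrals\<close>

text \<open>Domination of \<open>f\<close> alone suffices: Cauchy's inequality converts a local
  majorant \<open>g\<close> into the bound \<open>g t / r\<close> for the derivatives, hence for the
  difference quotients, and dominated convergence then allows differentiation under the
  integral.\<close>

lemma holomorphic_on_lebesgue_integral:
  fixes f :: "'a \<Rightarrow> complex \<Rightarrow> complex"
  assumes U: "open U"
    and hol: "\<And>t. f t holomorphic_on U"
    and meas: "\<And>z. z \<in> U \<Longrightarrow> (\<lambda>t. f t z) \<in> borel_measurable M"
    and dom: "\<And>z. z \<in> U \<Longrightarrow>
      \<exists>r g. r > 0 \<and> integrable M g \<and> (\<forall>w\<in>ball z r \<inter> U. \<forall>t. norm (f t w) \<le> g t)"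
  shows "(\<lambda>z. \<integral>t. f t z \<partial>M) holomorphic_on U"
  unfolding holomorphic_on_open[OF U]
proof
  fix z assume z: "z \<in> U"
  obtain r0 g where r0: "r0 > 0" "integrable M g"
    and g0: "\<forall>w\<in>ball z r0 \<inter> U. \<forall>t. norm (f t w) \<le> g t" using dom[OF z] by blast
  obtain r1 where r1: "r1 > 0" "ball z r1 \<subseteq> U" using U z open_contains_ball by blast
  \<comment> \<open>The quarter leaves room for Cauchy's inequality: a closed disc of radius
    \<open>r\<close> about any point of \<open>ball z r\<close> stays inside
    \<open>ball z (4 * r)\<close>, where both holomorphy and the majorant are available.\<close>
  define r where "r = min r0 r1 / 4"
  have r: "r > 0" and sub: "ball z (4 * r) \<subseteq> U" "ball z (4 * r) \<subseteq> ball z r0"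
    using r0 r1 by (auto simp: r_def)
  have g: "norm (f t w) \<le> g t" if "w \<in> ball z (4 * r)" for t w
    using g0 sub that by blast
  have bd: "norm (deriv (f t) w) \<le> g t / r" if w: "w \<in> ball z r" for t w
  proof -
    have s: "cball w r \<subseteq> ball z (4 * r)" using w r
      by (intro subsetI) (simp, smt (verit) dist_commute dist_triangle)
    have "cmod ((deriv ^^ 1) (f t) w) \<le> fact 1 * g t / r ^ 1"
    proof (rule Cauchy_inequality)
      show "f t holomorphic_on ball w r" "continuous_on (cball w r) (f t)"
        using s sub hol[of t] ball_subset_cball[of w r]
        by (meson holomorphic_on_subset holomorphic_on_imp_continuous_on order_trans)+
      show "\<And>v. cmod (w - v) = r \<Longrightarrow> cmod (f t v) \<le> g t"
        using g s by (force simp: dist_norm)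
    qed (use r in auto)
    then show ?thesis by simp
  qed
  have lip: "norm (f t w - f t z) \<le> g t / r * norm (w - z)" if w: "w \<in> ball z r" for t w
  proof (rule field_differentiable_bound[of "ball z r" "f t" "deriv (f t)"])
    fix v assume v: "v \<in> ball z r"
    then have "v \<in> U" using sub r by auto
    then show "(f t has_field_derivative deriv (f t) v) (at v within ball z r)"
      by (meson DERIV_subset U hol holomorphic_derivI subset_UNIV)
  qed (use w r bd in auto)
  show "\<exists>D. ((\<lambda>z. \<integral>t. f t z \<partial>M) has_field_derivative D) (at z)"
  proof (intro exI)
    let ?D = "\<lambda>t. deriv (f t) z"
    have int: "integrable M (\<lambda>t. f t w)" if "w \<in> ball z r" for w
      using that r sub g[of w] by (intro Bochner_Integration.integrable_bound[OF r0(2) meas])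
        (auto intro!: always_eventually order_trans[OF _ abs_ge_self])
    \<comment> \<open>The limit is tested along sequences so that dominated convergence applies.
      Staying in \<open>ball z r\<close> keeps the Lipschitz bound valid for every member; since the
      ball is open, the limit within it is the full limit.\<close>
    have "((\<lambda>w. ((\<integral>t. f t w \<partial>M) - (\<integral>t. f t z \<partial>M)) / (w - z)) \<longlongrightarrow> (\<integral>t. ?D t \<partial>M)) (at z within ball z r)"
      unfolding tendsto_at_iff_sequentially comp_def
    proof (intro allI impI)
      fix X :: "nat \<Rightarrow> complex"
      assume X: "\<forall>i. X i \<in> ball z r - {z}" "X \<longlonglongrightarrow> z"
      have eq: "((\<integral>t. f t (X n) \<partial>M) - (\<integral>t. f t z \<partial>M)) / (X n - z) = (\<integral>t. (f t (X n) - f t z) / (X n - z) \<partial>M)" for n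
        using int[of z] int[of "X n"] X r by simp
      have lim: "(\<lambda>n. (f t (X n) - f t z) / (X n - z)) \<longlonglongrightarrow> ?D t" for t
      proof -
        have "(f t has_field_derivative ?D t) (at z)"
          by (meson U hol holomorphic_derivI z)
        then have "((\<lambda>w. (f t w - f t z) / (w - z)) \<longlongrightarrow> ?D t) (at z)"
          by (simp add: has_field_derivative_iff)
        then show ?thesis using X by (auto simp: tendsto_at_iff_sequentially comp_def)
      qed
      have m: "(\<lambda>t. (f t (X n) - f t z) / (X n - z)) \<in> borel_measurable M" for n
        using int[of z] int[of "X n"] X r by (intro borel_measurable_divide borel_measurable_diff) auto
      show "(\<lambda>n. ((\<integral>t. f t (X n) \<partial>M) - (\<integral>t. f t z \<partial>M)) / (X n - z)) \<longlonglongrightarrow> (\<integral>t. ?D t \<partial>M)"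
        unfolding eq
      proof (rule integral_dominated_convergence)
        show "?D \<in> borel_measurable M"
          by (rule borel_measurable_LIMSEQ_metric[OF m]) (rule lim)
        show "integrable M (\<lambda>t. g t / r)" using r0 by simp
        show "AE t in M. norm ((f t (X n) - f t z) / (X n - z)) \<le> g t / r" for n
          using lip[of "X n"] X by (auto simp: norm_divide divide_le_eq intro!: always_eventually)
      qed (use m lim in auto)
    qed
    then show "((\<lambda>z. \<integral>t. f t z \<partial>M) has_field_derivative (\<integral>t. ?D t \<partial>M)) (at z)"
      using r by (simp only: has_field_derivative_iff at_within_open[OF centre_in_ball[THEN iffD2] open_ball])
  qed
qed

subsection \<open>The complementary error function\<close>

text \<open>The integrand is entire and so has a global primitive \<open>g\<close>; the contour
  integral in the definition is then \<open>g u - g 0\<close>.\<close>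

lemma has_field_derivative_erfc:
  "(erfc has_field_derivative (- 2 / complex_of_real (sqrt pi) * exp (- u\<^sup>2))) (at u)"
proof -
  have "(\<lambda>v::complex. exp (- v\<^sup>2)) holomorphic_on UNIV" by (intro holomorphic_intros)
  then obtain g where g: "\<And>z::complex. (g has_field_derivative exp (- z\<^sup>2)) (at z)"
    using holomorphic_convex_primitive'[of UNIV "\<lambda>v::complex. exp (- v\<^sup>2)"] by auto
  have "contour_integral (linepath 0 v) (\<lambda>v. exp (- v\<^sup>2)) = g v - g 0" for v
    using contour_integral_primitive[of UNIV g "\<lambda>v. exp (- v\<^sup>2)" "linepath 0 v"] g
    by (simp add: contour_integral_unique)
  then have e: "erfc = (\<lambda>u. 1 - 2 / complex_of_real (sqrt pi) * (g u - g 0))"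
    by (auto simp: erfc_def fun_eq_iff)
  show ?thesis unfolding e by (rule derivative_eq_intros g refl | simp)+
qed

lemma erfc_0 [simp]: "erfc 0 = 1"
  by (simp add: erfc_def)

text \<open>The derivative is even, so \<open>erfc (- v) + erfc v\<close> is constant, and the
  constant is read off at 0.\<close>

lemma erfc_minus: "erfc (- u) = 2 - erfc u"
proof -
  have "((\<lambda>v. erfc (- v) + erfc v) has_field_derivative 0) (at v within UNIV)" for v
    by (rule derivative_eq_intros DERIV_chain2[OF has_field_derivative_erfc] has_field_derivative_erfc refl | simp)+
  then obtain c where "\<And>v. erfc (- v) + erfc v = c"
    using has_field_derivative_zero_constant[of UNIV "\<lambda>v. erfc (- v) + erfc v"] by auto
  from this[of 0] this[of u] show ?thesis by (simp add: algebra_simps)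
qed

text \<open>On the nonnegative axis \<open>erfc\<close> is a truncated Gaussian integral, whose full
  value \<open>sqrt pi / 2\<close> is exactly what the normalization cancels.\<close>

lemma erfc_of_real_tendsto_0: "((\<lambda>x. erfc (complex_of_real x)) \<longlongrightarrow> 0) at_top"
proof -
  have I: "integrable lborel (\<lambda>x. indicator {0..} x *\<^sub>R exp (- x\<^sup>2) :: real)"
    "(\<integral>x. indicator {0..} x *\<^sub>R exp (- x\<^sup>2) \<partial>lborel) = sqrt pi / 2"
    using gaussian_moment_0 by (simp_all only: has_bochner_integral_iff)
  have "((\<lambda>x::real. 1 - 2 / complex_of_real (sqrt pi) *
          of_real (\<integral>t. indicator {..x} t *\<^sub>R (indicator {0..} t *\<^sub>R exp (- t\<^sup>2)) \<partial>lborel)) \<longlongrightarrow>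
       1 - 2 / complex_of_real (sqrt pi) * of_real (sqrt pi / 2)) at_top"
    using tendsto_integral_at_top[OF sets_lborel I(1)] unfolding I(2) by (intro tendsto_intros)
  moreover have "erfc (of_real x) = 1 - 2 / complex_of_real (sqrt pi) *
          of_real (\<integral>t. indicator {..x} t *\<^sub>R (indicator {0..} t *\<^sub>R exp (- t\<^sup>2)) \<partial>lborel)"
    if x: "x \<ge> 0" for x :: real
  proof -
    have d: "((\<lambda>t. - (of_real (sqrt pi) / 2) * erfc (of_real t)) has_vector_derivative of_real (exp (- t\<^sup>2))) (at t)" for t :: real
      by (rule has_vector_derivative_real_field derivative_eq_intros has_field_derivative_erfc refl
          | simp add: exp_of_real [symmetric])+
    have "(\<integral>t. indicator {0..x} t *\<^sub>R complex_of_real (exp (- t\<^sup>2)) \<partial>lborel) =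
       - (of_real (sqrt pi) / 2) * erfc (of_real x) - - (of_real (sqrt pi) / 2) * erfc (of_real 0)"
    proof (rule integral_FTC_Icc[OF x])
      show "continuous_on {0..x} (\<lambda>t. complex_of_real (exp (- t\<^sup>2)))" by (intro continuous_intros)
    qed (rule has_vector_derivative_at_within[OF d])
    moreover have "(\<integral>t. indicator {0..x} t *\<^sub>R complex_of_real (exp (- t\<^sup>2)) \<partial>lborel) =
      of_real (\<integral>t. indicator {..x} t *\<^sub>R (indicator {0..} t *\<^sub>R exp (- t\<^sup>2)) \<partial>lborel)"
      unfolding integral_complex_of_real[symmetric]
      by (rule Bochner_Integration.integral_cong) (auto simp: indicator_def)
    ultimately show ?thesis by (simp add: field_simps)
  qed
  ultimately have "((\<lambda>x. erfc (complex_of_real x)) \<longlongrightarrow>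
       1 - 2 / complex_of_real (sqrt pi) * of_real (sqrt pi / 2)) at_top"
    by (elim Lim_transform_eventually) (auto intro!: eventually_at_top_linorderI[of 0])
  then show ?thesis by simp
qed

text \<open>The real limit is carried over along the vertical segment from \<open>x\<close> to
  \<open>x + i y\<close>. There \<open>Re u = x\<close> and \<open>(Im u)^2\<close> is at most
  \<open>y^2\<close>, so the derivative is of size at most a multiple of
  \<open>exp (y^2 - x^2)\<close> and the difference dies out.\<close>

lemma erfc_tendsto_0: "((\<lambda>x. erfc (complex_of_real x + \<i> * of_real y)) \<longlongrightarrow> 0) at_top"
proof -
  have bd: "norm (erfc (complex_of_real x + \<i> * of_real y) - erfc (of_real x))
     \<le> (2 / sqrt pi * exp (y\<^sup>2) * \<bar>y\<bar>) * exp (- x\<^sup>2)" for x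
  proof -
    have "norm (erfc (complex_of_real x + \<i> * of_real y) - erfc (of_real x))
       \<le> (2 / sqrt pi * exp (y\<^sup>2 - x\<^sup>2)) * norm ((complex_of_real x + \<i> * of_real y) - of_real x)"
    proof (rule field_differentiable_bound[of "closed_segment (complex_of_real x) (complex_of_real x + \<i> * of_real y)"])
      show "norm (- 2 / complex_of_real (sqrt pi) * exp (- u\<^sup>2)) \<le> 2 / sqrt pi * exp (y\<^sup>2 - x\<^sup>2)"
        if u: "u \<in> closed_segment (complex_of_real x) (complex_of_real x + \<i> * of_real y)" for u
      proof -
        obtain s where s: "0 \<le> s" "s \<le> 1" "u = of_real x + of_real s * (\<i> * of_real y)"
          using u by (auto simp: closed_segment_def scaleR_conv_of_real algebra_simps)
        then have "(Im u)\<^sup>2 \<le> y\<^sup>2" "Re u = x"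
          by (auto simp: power_mult_distrib mult_left_le_one_le power_le_one)
        then show ?thesis
          by (simp add: norm_mult norm_divide Re_power2 divide_right_mono)
      qed
    qed (auto simp only: convex_closed_segment ends_in_segment
          intro!: has_field_derivative_at_within[OF has_field_derivative_erfc])
    then show ?thesis by (simp add: norm_mult exp_diff exp_minus divide_inverse mult_ac)
  qed
  have "((\<lambda>x::real. (2 / sqrt pi * exp (y\<^sup>2) * \<bar>y\<bar>) * exp (- x\<^sup>2)) \<longlongrightarrow> 0) at_top"
    by real_asymp
  then have "((\<lambda>x. erfc (complex_of_real x + \<i> * of_real y) - erfc (of_real x)) \<longlongrightarrow> 0) at_top"
    by (rule Lim_null_comparison[OF always_eventually, rotated]) (use bd in blast)
  from tendsto_add[OF this erfc_of_real_tendsto_0] show ?thesis by simp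
qed

subsection \<open>The complex Gaussian kernel\<close>

text \<open>This is the normal density with its mean continued to a complex number \<open>w\<close>;
  it is no longer positive, but it is entire in \<open>w\<close>.\<close>

definition gauss_kernel :: "real \<Rightarrow> complex \<Rightarrow> real \<Rightarrow> complex" where
  "gauss_kernel \<sigma> w t =
     exp (- ((complex_of_real t - w)\<^sup>2 / complex_of_real (2 * \<sigma>\<^sup>2))) / complex_of_real (sqrt (2 * pi) * \<sigma>)"

lemma gauss_kernel_measurable [measurable]: "gauss_kernel \<sigma> w \<in> borel_measurable borel"
  unfolding gauss_kernel_def by measurable

text \<open>The real part of \<open>-(t - w)^2\<close> is \<open>(Im w)^2 - (t - Re w)^2\<close>. A
  complex mean therefore costs only a factor independent of \<open>t\<close>.\<close>

lemma norm_gauss_kernel: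
  assumes "\<sigma> > 0"
  shows "norm (gauss_kernel \<sigma> w t) = exp ((Im w)\<^sup>2 / (2 * \<sigma>\<^sup>2)) * normal_density (Re w) \<sigma> t"
proof -
  have "sqrt (2 * pi * \<sigma>\<^sup>2) = sqrt (2 * pi) * \<sigma>" using assms by (simp add: real_sqrt_mult)
  moreover have "Re (- ((complex_of_real t - w)\<^sup>2 / complex_of_real (2 * \<sigma>\<^sup>2)))
      = (Im w)\<^sup>2 / (2 * \<sigma>\<^sup>2) + - (t - Re w)\<^sup>2 / (2 * \<sigma>\<^sup>2)"
    unfolding uminus_complex.sel Re_divide_of_real Re_power2
    by (simp add: diff_divide_distrib)
  ultimately show ?thesis using assms
    by (simp only: gauss_kernel_def normal_density_def norm_divide norm_of_real norm_exp_eq_Re exp_add) simp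
qed

text \<open>Completing the square: an exponential tilt with rate \<open>c\<close> moves the mean by
  \<open>c * \<sigma>^2\<close>. With \<open>c = n\<close> this evaluates the terms of the
  series.\<close>

lemma exp_mult_gauss_kernel:
  assumes "\<sigma> \<noteq> 0"
  shows "exp (c * of_real t) * gauss_kernel \<sigma> w t =
    exp (c * w + c\<^sup>2 * of_real (\<sigma>\<^sup>2 / 2)) * gauss_kernel \<sigma> (w + c * of_real (\<sigma>\<^sup>2)) t"
proof -
  have "c * of_real t + - ((complex_of_real t - w)\<^sup>2 / complex_of_real (2 * \<sigma>\<^sup>2)) =
    (c * w + c\<^sup>2 * of_real (\<sigma>\<^sup>2 / 2)) +
    - ((complex_of_real t - (w + c * of_real (\<sigma>\<^sup>2)))\<^sup>2 / complex_of_real (2 * \<sigma>\<^sup>2))"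
    using assms by (simp add: field_simps power2_eq_square)
  then have "exp (c * of_real t) * exp (- ((complex_of_real t - w)\<^sup>2 / complex_of_real (2 * \<sigma>\<^sup>2))) =
    exp (c * w + c\<^sup>2 * of_real (\<sigma>\<^sup>2 / 2)) *
    exp (- ((complex_of_real t - (w + c * of_real (\<sigma>\<^sup>2)))\<^sup>2 / complex_of_real (2 * \<sigma>\<^sup>2)))"
    by (simp only: exp_add[symmetric])
  then show ?thesis by (simp only: gauss_kernel_def times_divide_eq_right)
qed

text \<open>The same completion of the square for real means, used on the moduli.\<close>

lemma exp_mult_normal_density:
  assumes "\<sigma> \<noteq> 0"
  shows "exp (n * t) * normal_density a \<sigma> t =
    exp (n * a + n\<^sup>2 * \<sigma>\<^sup>2 / 2) * normal_density (a + n * \<sigma>\<^sup>2) \<sigma> t"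
proof -
  have "n * t + - (t - a)\<^sup>2 / (2 * \<sigma>\<^sup>2) =
    (n * a + n\<^sup>2 * \<sigma>\<^sup>2 / 2) + - (t - (a + n * \<sigma>\<^sup>2))\<^sup>2 / (2 * \<sigma>\<^sup>2)"
    using assms by (simp add: field_simps power2_eq_square)
  then have "exp (n * t) * exp (- (t - a)\<^sup>2 / (2 * \<sigma>\<^sup>2)) =
    exp (n * a + n\<^sup>2 * \<sigma>\<^sup>2 / 2) * exp (- (t - (a + n * \<sigma>\<^sup>2))\<^sup>2 / (2 * \<sigma>\<^sup>2))"
    by (simp only: exp_add[symmetric])
  then show ?thesis by (simp only: normal_density_def mult.left_commute[of _ "1 / sqrt (2 * pi * \<sigma>\<^sup>2)"])
qed

text \<open>The common source of the estimates. The majorant \<open>c * exp (n * t)\<close> tilts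
  the modulus of the kernel into a multiple of another normal density, whose mass is 1. The case
  \<open>n = 0\<close> serves for bounded \<open>h\<close>; \<open>n = 1\<close> produces the factor
  \<open>exp (Re w)\<close>, which is proportional to the modulus of \<open>z\<close> when
  \<open>w = \<mu> + Ln z\<close>.\<close>

lemma
  fixes h :: "real \<Rightarrow> complex"
  assumes \<sigma>: "\<sigma> > 0" and [measurable]: "h \<in> borel_measurable borel"
    and h: "\<And>t. norm (h t) \<le> c * exp (n * t)"
  shows integrable_mult_gauss_kernel: "integrable lborel (\<lambda>t. h t * gauss_kernel \<sigma> w t)"
    and norm_integral_mult_gauss_kernel_le:
      "norm (\<integral>t. h t * gauss_kernel \<sigma> w t \<partial>lborel)
        \<le> c * exp ((Im w)\<^sup>2 / (2 * \<sigma>\<^sup>2)) * exp (n * Re w + n\<^sup>2 * \<sigma>\<^sup>2 / 2)"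
proof -
  let ?C = "c * exp ((Im w)\<^sup>2 / (2 * \<sigma>\<^sup>2)) * exp (n * Re w + n\<^sup>2 * \<sigma>\<^sup>2 / 2)"
  let ?g = "\<lambda>t. ?C * normal_density (Re w + n * \<sigma>\<^sup>2) \<sigma> t"
  have le: "norm (h t * gauss_kernel \<sigma> w t) \<le> ?g t" for t
  proof -
    have "norm (h t * gauss_kernel \<sigma> w t)
        \<le> c * exp (n * t) * (exp ((Im w)\<^sup>2 / (2 * \<sigma>\<^sup>2)) * normal_density (Re w) \<sigma> t)"
      unfolding norm_mult norm_gauss_kernel[OF \<sigma>] by (intro mult_right_mono h) simp
    also have "\<dots> = c * exp ((Im w)\<^sup>2 / (2 * \<sigma>\<^sup>2)) * (exp (n * t) * normal_density (Re w) \<sigma> t)"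
      by (simp only: mult_ac)
    also have "\<dots> = ?g t"
      using \<sigma> by (subst exp_mult_normal_density) (simp_all add: mult_ac)
    finally show ?thesis .
  qed
  have g: "integrable lborel ?g" using \<sigma> by (intro integrable_mult_right integrable_normal_density)
  show i: "integrable lborel (\<lambda>t. h t * gauss_kernel \<sigma> w t)"
    by (rule Bochner_Integration.integrable_bound[OF g])
      (use le in \<open>auto intro!: always_eventually order_trans[OF le abs_ge_self]\<close>)
  have "norm (\<integral>t. h t * gauss_kernel \<sigma> w t \<partial>lborel) \<le> integral\<^sup>L lborel ?g"
    by (rule Bochner_Integration.integral_norm_bound_integral[OF i g le])
  also have "\<dots> = ?C" using integral_normal_density[OF \<sigma>] by (simp only: integral_mult_right_zero mult_1_right)
  finally show "norm (\<integral>t. h t * gauss_kernel \<sigma> w t \<partial>lborel) \<le> ?C" .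
qed

lemma integrable_gauss_kernel: "\<sigma> > 0 \<Longrightarrow> integrable lborel (gauss_kernel \<sigma> w)"
  using integrable_mult_gauss_kernel[of \<sigma> "\<lambda>_. 1" 1 0 w] by simp

text \<open>The antiderivative is the normal distribution function with complex mean. Its argument
  has \<open>w - t\<close>, not \<open>t - w\<close>, so that it runs from 0 at minus infinity to 1
  at plus infinity.\<close>

lemma erfc_gauss_kernel_derivative:
  assumes \<sigma>: "\<sigma> > 0"
  shows "((\<lambda>t. 1 / 2 * erfc ((w - of_real t) / of_real (sqrt 2 * \<sigma>))) has_vector_derivative
    gauss_kernel \<sigma> w t) (at t)"
proof -
  let ?s = "complex_of_real (sqrt 2 * \<sigma>)"
  have s2: "?s\<^sup>2 = of_real (2 * \<sigma>\<^sup>2)" by (simp add: power_mult_distrib flip: of_real_power)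
  have nz: "?s \<noteq> 0" using \<sigma> by simp
  have "((\<lambda>v. 1 / 2 * erfc ((w - v) / ?s)) has_field_derivative
     1 / 2 * ((- 2 / complex_of_real (sqrt pi) * exp (- ((w - v) / ?s)\<^sup>2)) * (- 1 / ?s))) (at v)" for v
    using nz by (intro DERIV_cmult DERIV_chain2[OF has_field_derivative_erfc]) (auto intro!: derivative_eq_intros)
  moreover have "1 / 2 * ((- 2 / complex_of_real (sqrt pi) * exp (- ((w - of_real t) / ?s)\<^sup>2)) * (- 1 / ?s))
      = gauss_kernel \<sigma> w t"
  proof -
    have "((w - of_real t) / ?s)\<^sup>2 = (of_real t - w)\<^sup>2 / of_real (2 * \<sigma>\<^sup>2)"
      by (simp only: power_divide s2 power2_commute)
    then show ?thesis by (simp add: gauss_kernel_def real_sqrt_mult)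
  qed
  ultimately have "((\<lambda>v. 1 / 2 * erfc ((w - v) / ?s)) has_field_derivative gauss_kernel \<sigma> w t) (at (of_real t))"
    by metis
  then show ?thesis by (rule has_vector_derivative_real_field)
qed

text \<open>As \<open>t\<close> decreases, the argument moves to the right along a horizontal line,
  because its imaginary part does not depend on \<open>t\<close>.\<close>

lemma erfc_gauss_kernel_at_bot:
  assumes \<sigma>: "\<sigma> > 0"
  shows "((\<lambda>t. 1 / 2 * erfc ((w - of_real t) / of_real (sqrt 2 * \<sigma>))) \<longlongrightarrow> 0) at_bot"
proof -
  have "filterlim (\<lambda>t. (Re w - t) / (sqrt 2 * \<sigma>)) at_top at_bot"
    using \<sigma> by real_asymp
  from tendsto_mult_right_zero[OF filterlim_compose[OF erfc_tendsto_0[of "Im w / (sqrt 2 * \<sigma>)"] this], of "1/2"]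
  have "((\<lambda>t. 1 / 2 * erfc (of_real ((Re w - t) / (sqrt 2 * \<sigma>)) + \<i> * of_real (Im w / (sqrt 2 * \<sigma>)))) \<longlongrightarrow> 0) at_bot" .
  moreover have "of_real ((Re w - t) / (sqrt 2 * \<sigma>)) + \<i> * of_real (Im w / (sqrt 2 * \<sigma>)) = (w - of_real t) / of_real (sqrt 2 * \<sigma>)" for t
    by (simp add: complex_eq_iff Re_divide_of_real Im_divide_of_real del: of_real_mult)
  ultimately show ?thesis by simp
qed

text \<open>Reflection \<open>erfc (- u) = 2 - erfc u\<close> reduces this to the other end with
  \<open>- w\<close> as mean.\<close>

lemma erfc_gauss_kernel_at_top:
  assumes \<sigma>: "\<sigma> > 0"
  shows "((\<lambda>t. 1 / 2 * erfc ((w - of_real t) / of_real (sqrt 2 * \<sigma>))) \<longlongrightarrow> 1) at_top"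
proof -
  have "((\<lambda>t. 1 / 2 * erfc ((- w - of_real (- t)) / of_real (sqrt 2 * \<sigma>))) \<longlongrightarrow> 0) at_top"
    using filterlim_compose[OF erfc_gauss_kernel_at_bot[OF \<sigma>] filterlim_uminus_at_bot_at_top] .
  from tendsto_diff[OF tendsto_const[of 1] this]
  have "((\<lambda>t. 1 - 1 / 2 * erfc (- ((w - of_real t) / of_real (sqrt 2 * \<sigma>)))) \<longlongrightarrow> 1) at_top"
    by (simp add: minus_divide_left add.commute)
  then show ?thesis by (simp add: erfc_minus algebra_simps)
qed

lemma isCont_gauss_kernel: "isCont (gauss_kernel \<sigma> w) t"
  unfolding gauss_kernel_def divide_inverse by (intro continuous_intros)

text \<open>The fundamental theorem of calculus on a half-line; this is where the
  \<open>erfc\<close> factor of \<open>S_term\<close> comes from.\<close>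

lemma integral_gauss_kernel_lessThan:
  assumes \<sigma>: "\<sigma> > 0"
  shows "(\<integral>t. indicator {..<c} t * gauss_kernel \<sigma> w t \<partial>lborel) =
    1 / 2 * erfc ((w - of_real c) / of_real (sqrt 2 * \<sigma>))"
proof -
  let ?F = "\<lambda>t. 1 / 2 * erfc ((w - of_real t) / of_real (sqrt 2 * \<sigma>))"
  have "(LBINT t=-\<infinity>..ereal c. gauss_kernel \<sigma> w t) = ?F c - 0"
  proof (rule interval_integral_FTC_integrable)
    show "set_integrable lborel (einterval (- \<infinity>) (ereal c)) (gauss_kernel \<sigma> w)"
      unfolding set_integrable_def
      by (rule integrable_mult_indicator[OF _ integrable_gauss_kernel[OF \<sigma>]]) simp
    show "((?F \<circ> real_of_ereal) \<longlongrightarrow> 0) (at_right (- \<infinity>))"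
      unfolding ereal_tendsto_simps by (rule erfc_gauss_kernel_at_bot[OF \<sigma>])
    have "isCont ?F c"
      by (rule has_vector_derivative_continuous[OF erfc_gauss_kernel_derivative[OF \<sigma>]])
    then show "((?F \<circ> real_of_ereal) \<longlongrightarrow> ?F c) (at_left (ereal c))"
      unfolding ereal_tendsto_simps isCont_def by (rule filterlim_mono) (auto simp: at_le)
  qed (rule erfc_gauss_kernel_derivative[OF \<sigma>] isCont_gauss_kernel | simp)+
  moreover have "(LBINT t=-\<infinity>..ereal c. gauss_kernel \<sigma> w t) = (\<integral>t. indicator {..<c} t * gauss_kernel \<sigma> w t \<partial>lborel)"
    unfolding interval_lebesgue_integral_def set_lebesgue_integral_def
    by (auto simp: einterval_def indicator_def scaleR_conv_of_real intro!: Bochner_Integration.integral_cong)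
  ultimately show ?thesis by simp
qed

text \<open>The two limits of the antiderivative give the mass for complex \<open>w\<close>
  directly, without a shift of contour.\<close>

lemma integral_gauss_kernel:
  assumes \<sigma>: "\<sigma> > 0"
  shows "(\<integral>t. gauss_kernel \<sigma> w t \<partial>lborel) = 1"
proof -
  let ?F = "\<lambda>t. 1 / 2 * erfc ((w - of_real t) / of_real (sqrt 2 * \<sigma>))"
  have "(LBINT t=-\<infinity>..\<infinity>. gauss_kernel \<sigma> w t) = 1 - 0"
  proof (rule interval_integral_FTC_integrable)
    show "set_integrable lborel (einterval (- \<infinity>) \<infinity>) (gauss_kernel \<sigma> w)"
      unfolding set_integrable_def
      by (rule integrable_mult_indicator[OF _ integrable_gauss_kernel[OF \<sigma>]]) simp
    show "((?F \<circ> real_of_ereal) \<longlongrightarrow> 0) (at_right (- \<infinity>))"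
      unfolding ereal_tendsto_simps by (rule erfc_gauss_kernel_at_bot[OF \<sigma>])
    show "((?F \<circ> real_of_ereal) \<longlongrightarrow> 1) (at_left \<infinity>)"
      unfolding ereal_tendsto_simps by (rule erfc_gauss_kernel_at_top[OF \<sigma>])
  qed (rule erfc_gauss_kernel_derivative[OF \<sigma>] isCont_gauss_kernel | simp)+
  then show ?thesis
    by (simp add: interval_lebesgue_integral_def set_lebesgue_integral_def)
qed

subsection \<open>The transform as a Gaussian integral\<close>

text \<open>The variable is \<open>w\<close>, standing for \<open>\<mu> + Ln z\<close>, rather than
  \<open>z\<close>: in \<open>w\<close> the integral is entire, and the branch of the logarithm
  enters only through the substitution.\<close>

definition lognormal_phi_integral :: "real \<Rightarrow> complex \<Rightarrow> complex" where
  "lognormal_phi_integral \<sigma> w = (\<integral>t. of_real (exp (- exp t)) * gauss_kernel \<sigma> w t \<partial>lborel)"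

text \<open>The constant 1 is the mass of the kernel, so it moves inside the integral, where
  \<open>1 - exp (- exp t) \<le> exp t\<close> allows the weighted bound with
  \<open>n = 1\<close>.\<close>

lemma lognormal_phi_integral_minus_1:
  assumes \<sigma>: "\<sigma> > 0"
  shows "norm (lognormal_phi_integral \<sigma> w - 1)
    \<le> exp ((Im w)\<^sup>2 / (2 * \<sigma>\<^sup>2)) * exp (Re w + \<sigma>\<^sup>2 / 2)"
proof -
  have "lognormal_phi_integral \<sigma> w - 1
      = (\<integral>t. of_real (exp (- exp t)) * gauss_kernel \<sigma> w t - gauss_kernel \<sigma> w t \<partial>lborel)"
    unfolding lognormal_phi_integral_def
    using integrable_mult_gauss_kernel[OF \<sigma>, of "\<lambda>t. of_real (exp (- exp t))" 1 0 w]
    by (subst Bochner_Integration.integral_diff) (auto simp: integral_gauss_kernel[OF \<sigma>] integrable_gauss_kernel[OF \<sigma>])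
  also have "\<dots> = (\<integral>t. of_real (exp (- exp t) - 1) * gauss_kernel \<sigma> w t \<partial>lborel)"
    by (simp add: algebra_simps)
  also have "norm \<dots> \<le> 1 * exp ((Im w)\<^sup>2 / (2 * \<sigma>\<^sup>2)) * exp (1 * Re w + 1\<^sup>2 * \<sigma>\<^sup>2 / 2)"
  proof (rule norm_integral_mult_gauss_kernel_le[OF \<sigma>])
    show "norm (complex_of_real (exp (- exp t) - 1)) \<le> 1 * exp (1 * t)" for t
      using exp_ge_add_one_self[of "- exp t"] unfolding norm_of_real by simp
  qed measurable
  finally show ?thesis by simp
qed

lemma holomorphic_gauss_kernel: "\<sigma> \<noteq> 0 \<Longrightarrow> (\<lambda>w. gauss_kernel \<sigma> w t) holomorphic_on A"
  unfolding gauss_kernel_def by (intro holomorphic_intros) auto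

text \<open>A majorant uniform over means in a bounded interval, obtained by doubling the variance;
  the factor \<open>sqrt 2\<close> corrects the normalization.\<close>

lemma normal_density_le_centered:
  assumes "\<sigma> > 0" "\<bar>a\<bar> \<le> A"
  shows "normal_density a \<sigma> t
    \<le> exp (A\<^sup>2 / (2 * \<sigma>\<^sup>2)) * (sqrt 2 * normal_density 0 (sqrt 2 * \<sigma>) t)"
proof -
  have s: "sqrt (2 * pi * (sqrt 2 * \<sigma>)\<^sup>2) = sqrt 2 * sqrt (2 * pi * \<sigma>\<^sup>2)"
    by (simp add: power_mult_distrib real_sqrt_mult)
  have "a\<^sup>2 \<le> A\<^sup>2" using assms(2) by (rule abs_le_square_iff[THEN iffD1, OF order_trans, OF _ abs_ge_self])
  \<comment> \<open>This square equals \<open>2 * (t - a)^2 + 2 * a^2 - t^2\<close>.\<close>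
  moreover have "0 \<le> (t - 2 * a)\<^sup>2" by simp
  ultimately have "t\<^sup>2 \<le> 2 * (t - a)\<^sup>2 + 2 * A\<^sup>2"
    by (simp add: power2_eq_square algebra_simps)
  then have "- (t - a)\<^sup>2 / (2 * \<sigma>\<^sup>2) \<le> A\<^sup>2 / (2 * \<sigma>\<^sup>2) + - t\<^sup>2 / (2 * (sqrt 2 * \<sigma>)\<^sup>2)"
    using assms(1) by (simp add: power_mult_distrib field_simps)
  then have "exp (- (t - a)\<^sup>2 / (2 * \<sigma>\<^sup>2))
      \<le> exp (A\<^sup>2 / (2 * \<sigma>\<^sup>2)) * exp (- t\<^sup>2 / (2 * (sqrt 2 * \<sigma>)\<^sup>2))"
    unfolding exp_add[symmetric] exp_le_cancel_iff .
  then show ?thesis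
    unfolding normal_density_def s using assms(1) by (simp add: field_simps)
qed

lemma holomorphic_lognormal_phi_integral:
  assumes \<sigma>: "\<sigma> > 0"
  shows "lognormal_phi_integral \<sigma> holomorphic_on UNIV"
  unfolding lognormal_phi_integral_def[abs_def]
proof (rule holomorphic_on_lebesgue_integral)
  fix z :: complex
  let ?f = "\<lambda>w t. complex_of_real (exp (- exp t)) * gauss_kernel \<sigma> w t"
  \<comment> \<open>On the unit ball about \<open>z\<close> the real and imaginary parts change by
    at most 1. \<open>?B\<close> absorbs the imaginary part, the centred density in
    \<open>?g\<close> the real part.\<close>
  let ?B = "exp ((\<bar>Im z\<bar> + 1)\<^sup>2 / (2 * \<sigma>\<^sup>2))"
  let ?g = "\<lambda>t. ?B * (exp ((\<bar>Re z\<bar> + 1)\<^sup>2 / (2 * \<sigma>\<^sup>2)) * (sqrt 2 * normal_density 0 (sqrt 2 * \<sigma>) t))"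
  show "\<exists>r g. r > 0 \<and> integrable lborel g \<and> (\<forall>w\<in>ball z r \<inter> UNIV. \<forall>t. norm (?f w t) \<le> g t)"
  proof (intro exI conjI ballI allI)
    show "(1::real) > 0" by simp
    show "integrable lborel ?g"
      using \<sigma> by (intro integrable_mult_right integrable_normal_density) simp
    fix w t assume "w \<in> ball z 1 \<inter> UNIV"
    then have "norm (w - z) < 1" by (simp add: dist_norm norm_minus_commute)
    with abs_Re_le_cmod[of "w - z"] abs_Im_le_cmod[of "w - z"]
    have w: "\<bar>Re w\<bar> \<le> \<bar>Re z\<bar> + 1" "\<bar>Im w\<bar> \<le> \<bar>Im z\<bar> + 1" by auto
    have "norm (?f w t) \<le> norm (gauss_kernel \<sigma> w t)"
      by (simp add: norm_mult mult_left_le_one_le)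
    also have "\<dots> \<le> ?g t"
      unfolding norm_gauss_kernel[OF \<sigma>]
    proof (rule mult_mono[OF _ normal_density_le_centered[OF \<sigma> w(1)]])
      have "(Im w)\<^sup>2 \<le> (\<bar>Im z\<bar> + 1)\<^sup>2" using w(2) by (simp add: abs_le_square_iff[symmetric])
      then show "exp ((Im w)\<^sup>2 / (2 * \<sigma>\<^sup>2)) \<le> ?B" by (simp add: divide_right_mono)
    qed auto
    finally show "norm (?f w t) \<le> ?g t" .
  qed
qed (use \<sigma> in \<open>auto intro!: holomorphic_intros holomorphic_gauss_kernel\<close>)

section \<open>Cutting the integral: the upper tail, and the series below the cut\<close>

lemma lognormal_phi_integral_split:
  assumes \<sigma>: "\<sigma> > 0"
  shows "lognormal_phi_integral \<sigma> w =
    (\<integral>t. indicator {..<c} t * of_real (exp (- exp t)) * gauss_kernel \<sigma> w t \<partial>lborel) +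
    (\<integral>t. indicator {c..} t * of_real (exp (- exp t)) * gauss_kernel \<sigma> w t \<partial>lborel)"
proof -
  have i: "integrable lborel (\<lambda>t. indicator A t * of_real (exp (- exp t)) * gauss_kernel \<sigma> w t)"
    if [measurable]: "A \<in> sets borel" for A
    by (rule integrable_mult_gauss_kernel[OF \<sigma>, of _ 1 0]) (auto simp: indicator_def norm_mult)
  have "(\<integral>t. indicator {..<c} t * of_real (exp (- exp t)) * gauss_kernel \<sigma> w t \<partial>lborel) +
    (\<integral>t. indicator {c..} t * of_real (exp (- exp t)) * gauss_kernel \<sigma> w t \<partial>lborel) =
    (\<integral>t. indicator {..<c} t * of_real (exp (- exp t)) * gauss_kernel \<sigma> w t +
      indicator {c..} t * of_real (exp (- exp t)) * gauss_kernel \<sigma> w t \<partial>lborel)"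
    by (rule Bochner_Integration.integral_add[symmetric]) (auto intro: i)
  also have "\<dots> = lognormal_phi_integral \<sigma> w"
    unfolding lognormal_phi_integral_def
    by (rule Bochner_Integration.integral_cong) (auto simp: indicator_def)
  finally show ?thesis by simp
qed

text \<open>The first bound uses \<open>exp (- exp t) \<le> exp (- \<alpha>)\<close> above the cut
  and gives the error uniform in \<open>z\<close>. The second uses
  \<open>exp (- exp t) \<le> 1 \<le> exp t\<close>, valid there because
  \<open>\<alpha> \<ge> 1\<close>, and gives decay as \<open>z\<close> tends to 0.\<close>

lemma upper_tail_le:
  assumes \<sigma>: "\<sigma> > 0" and \<alpha>: "\<alpha> \<ge> 1"
  shows "norm (\<integral>t. indicator {ln \<alpha>..} t * of_real (exp (- exp t)) * gauss_kernel \<sigma> w t \<partial>lborel)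
      \<le> exp (- \<alpha>) * exp ((Im w)\<^sup>2 / (2 * \<sigma>\<^sup>2))" (is "?L \<le> ?R1")
    and "norm (\<integral>t. indicator {ln \<alpha>..} t * of_real (exp (- exp t)) * gauss_kernel \<sigma> w t \<partial>lborel)
      \<le> exp ((Im w)\<^sup>2 / (2 * \<sigma>\<^sup>2)) * exp (Re w + \<sigma>\<^sup>2 / 2)" (is "?L \<le> ?R2")
proof -
  have \<alpha>_le: "\<alpha> \<le> exp t" if "ln \<alpha> \<le> t" for t
    using that \<alpha> by (metis exp_le_cancel_iff exp_ln less_le_trans zero_less_one)
  have "?L \<le> exp (- \<alpha>) * exp ((Im w)\<^sup>2 / (2 * \<sigma>\<^sup>2)) * exp (0 * Re w + 0\<^sup>2 * \<sigma>\<^sup>2 / 2)"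
    by (rule norm_integral_mult_gauss_kernel_le[OF \<sigma>])
      (auto simp: indicator_def norm_mult \<alpha>_le)
  then show "?L \<le> ?R1" by simp
  have "?L \<le> 1 * exp ((Im w)\<^sup>2 / (2 * \<sigma>\<^sup>2)) * exp (1 * Re w + 1\<^sup>2 * \<sigma>\<^sup>2 / 2)"
  proof (rule norm_integral_mult_gauss_kernel_le[OF \<sigma>])
    fix t
    have "exp (- exp t) \<le> exp t" if "ln \<alpha> \<le> t"
    proof -
      have "exp (- exp t) \<le> 1" by simp
      also have "1 \<le> exp t" using \<alpha>_le[OF that] \<alpha> by linarith
      finally show ?thesis .
    qed
    then show "norm (indicator {ln \<alpha>..} t * complex_of_real (exp (- exp t))) \<le> 1 * exp (1 * t)"
      by (auto simp: indicator_def norm_mult)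
  qed measurable
  then show "?L \<le> ?R2" by simp
qed

text \<open>Tilting by \<open>exp (n * t)\<close> moves the mean to
  \<open>w + n * \<sigma>^2\<close>. The prefactor of the tilt supplies \<open>z ^ n\<close> and the
  lognormal moment, and the mass of the shifted kernel below the cut supplies
  \<open>erfc\<close>.\<close>

lemma S_term_eq_integral:
  assumes \<sigma>: "\<sigma> > 0" and \<alpha>: "\<alpha> > 0" and z: "z \<noteq> 0"
  shows "S_term \<mu> \<sigma> \<alpha> z n = (\<integral>t. indicator {..<ln \<alpha>} t * ((- of_real (exp t)) ^ n / fact n) *
     gauss_kernel \<sigma> (of_real \<mu> + Ln z) t \<partial>lborel)"
proof -
  let ?w = "of_real \<mu> + Ln z"
  let ?w' = "?w + of_nat n * of_real (\<sigma>\<^sup>2)"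
  let ?C = "(- 1) ^ n / fact n * exp (of_nat n * ?w + (of_nat n)\<^sup>2 * of_real (\<sigma>\<^sup>2 / 2))"
  have "(\<integral>t. indicator {..<ln \<alpha>} t * ((- of_real (exp t)) ^ n / fact n) * gauss_kernel \<sigma> ?w t \<partial>lborel) =
    (\<integral>t. ?C * (indicator {..<ln \<alpha>} t * gauss_kernel \<sigma> ?w' t) \<partial>lborel)"
  proof (rule Bochner_Integration.integral_cong[OF refl])
    fix t :: real
    have "(- of_real (exp t)) ^ n = (- 1) ^ n * exp (of_nat n * complex_of_real t)"
      unfolding exp_of_nat_mult exp_of_real by (rule power_minus)
    then have "indicator {..<ln \<alpha>} t * ((- of_real (exp t)) ^ n / fact n) * gauss_kernel \<sigma> ?w t =
      (- 1) ^ n / fact n * indicator {..<ln \<alpha>} t * (exp (of_nat n * of_real t) * gauss_kernel \<sigma> ?w t)"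
      by simp
    also have "\<dots> = ?C * (indicator {..<ln \<alpha>} t * gauss_kernel \<sigma> ?w' t)"
      using \<sigma> by (subst exp_mult_gauss_kernel) (auto simp only: mult_ac)
    finally show "indicator {..<ln \<alpha>} t * ((- of_real (exp t)) ^ n / fact n) * gauss_kernel \<sigma> ?w t =
      ?C * (indicator {..<ln \<alpha>} t * gauss_kernel \<sigma> ?w' t)" .
  qed
  also have "\<dots> = ?C * (1 / 2 * erfc ((?w' - of_real (ln \<alpha>)) / of_real (sqrt 2 * \<sigma>)))"
    by (simp only: integral_mult_right_zero integral_gauss_kernel_lessThan[OF \<sigma>])
  \<comment> \<open>Dividing by a positive real leaves the argument of \<open>z\<close> unchanged,
    so \<open>Ln\<close> splits exactly, with no jump of branch.\<close>
  also have "?w' - of_real (ln \<alpha>) = of_real \<mu> + Ln (z / of_real \<alpha>) + of_real (\<sigma>\<^sup>2 * real n)"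
    using \<alpha> z by (simp add: Ln_divide_of_real)
  also have "?C = (- z) ^ n / fact n * of_real (exp (\<mu> * real n + \<sigma>\<^sup>2 / 2 * (real n)\<^sup>2))"
  proof -
    have "exp (of_nat n * ?w + (of_nat n)\<^sup>2 * of_real (\<sigma>\<^sup>2 / 2)) =
      exp (of_nat n * Ln z) * of_real (exp (\<mu> * real n + \<sigma>\<^sup>2 / 2 * (real n)\<^sup>2))"
      unfolding exp_of_real[symmetric] exp_add[symmetric] by (simp add: algebra_simps)
    also have "exp (of_nat n * Ln z) = z ^ n" using z by (simp add: exp_of_nat_mult)
    finally show ?thesis by (simp add: power_minus[of z])
  qed
  finally show ?thesis by (simp only: S_term_def)
qed

text \<open>Below the cut \<open>exp t \<le> \<alpha>\<close>, so the \<open>n\<close>-th summand is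
  dominated by \<open>\<alpha> ^ n / fact n\<close> times the modulus of the kernel. These bounds
  are summable, which permits exchanging sum and integral in spite of the factor
  \<open>exp (\<sigma>^2 * n^2 / 2)\<close> in the terms.\<close>

lemma S_term_sums:
  assumes \<sigma>: "\<sigma> > 0" and \<alpha>: "\<alpha> > 0" and z: "z \<noteq> 0"
  shows "S_term \<mu> \<sigma> \<alpha> z sums
    (\<integral>t. indicator {..<ln \<alpha>} t * of_real (exp (- exp t)) * gauss_kernel \<sigma> (of_real \<mu> + Ln z) t \<partial>lborel)"
proof -
  define w where "w = of_real \<mu> + Ln z"
  let ?h = "\<lambda>n t. indicator {..<ln \<alpha>} t * ((- complex_of_real (exp t)) ^ n / fact n)"
  let ?f = "\<lambda>n t. ?h n t * gauss_kernel \<sigma> w t"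
  \<comment> \<open>The factor \<open>exp (0 * t)\<close> puts a constant bound into the exponential
    form that \<open>integrable_mult_gauss_kernel\<close> expects.\<close>
  have h_le: "norm (?h n t) \<le> \<alpha> ^ n / fact n * exp (0 * t)" for n t
  proof (cases "t < ln \<alpha>")
    case True
    then have "exp t \<le> \<alpha>" using \<alpha> by (metis exp_le_cancel_iff exp_ln less_imp_le)
    then show ?thesis using True
      by (simp add: norm_mult norm_divide norm_power divide_right_mono power_mono)
  qed (use \<alpha> in simp)
  have int: "integrable lborel (?f n)" for n
    by (rule integrable_mult_gauss_kernel[OF \<sigma> _ h_le]) measurable
  have hs: "(\<lambda>n. ?h n t) sums (indicator {..<ln \<alpha>} t * of_real (exp (- exp t)))" for t
  proof -
    have "(\<lambda>n. (- complex_of_real (exp t)) ^ n / fact n) sums exp (- complex_of_real (exp t))"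
      using exp_converges[of "- complex_of_real (exp t)"] by (simp add: scaleR_conv_of_real field_simps)
    from sums_mult[OF this, of "indicator {..<ln \<alpha>} t"] show ?thesis by (simp add: exp_of_real[symmetric])
  qed
  have se: "summable (\<lambda>n. \<alpha> ^ n / fact n * c)" for c :: real
    using summable_exp[of \<alpha>] by (intro summable_mult2) (simp add: field_simps)
  have "(\<lambda>n. integral\<^sup>L lborel (?f n)) sums (\<integral>t. (\<Sum>n. ?f n t) \<partial>lborel)"
  proof (rule sums_integral[OF int])
    have "summable (\<lambda>n. norm (?f n t))" for t
      unfolding norm_mult[of "?h _ t"]
      by (rule summable_mult2, rule summable_comparison_test'[OF se[of "exp (0 * t)"]]) (use h_le[of t] in simp)
    then show "AE t in lborel. summable (\<lambda>n. norm (?f n t))" by simp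
    show "summable (\<lambda>n. \<integral>t. norm (?f n t) \<partial>lborel)"
    proof (rule summable_comparison_test'[OF se[of "\<integral>t. norm (gauss_kernel \<sigma> w t) \<partial>lborel"]])
      fix n :: nat
      have "norm (\<integral>t. norm (?f n t) \<partial>lborel) = (\<integral>t. norm (?f n t) \<partial>lborel)" by simp
      also have "\<dots> \<le> (\<integral>t. \<alpha> ^ n / fact n * norm (gauss_kernel \<sigma> w t) \<partial>lborel)"
      proof (rule integral_mono)
        show "norm (?f n t) \<le> \<alpha> ^ n / fact n * norm (gauss_kernel \<sigma> w t)" for t
          unfolding norm_mult[of "?h n t"] using h_le[of t n] by (intro mult_right_mono) auto
      qed (intro integrable_norm int integrable_mult_right integrable_gauss_kernel[OF \<sigma>])+
      finally show "norm (\<integral>t. norm (?f n t) \<partial>lborel) \<le> \<alpha> ^ n / fact n * (\<integral>t. norm (gauss_kernel \<sigma> w t) \<partial>lborel)"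
        by simp
    qed
  qed
  moreover have "(\<Sum>n. ?f n t) = indicator {..<ln \<alpha>} t * of_real (exp (- exp t)) * gauss_kernel \<sigma> w t" for t
    using sums_mult2[OF hs] by (rule sums_unique[symmetric])
  moreover have "S_term \<mu> \<sigma> \<alpha> z = (\<lambda>n. integral\<^sup>L lborel (?f n))"
    by (intro ext) (simp only: S_term_eq_integral[OF assms] w_def)
  ultimately show ?thesis by (simp only: w_def)
qed

subsection \<open>Identification with the analytic continuation\<close>

lemma gauss_kernel_of_real:
  "\<sigma> > 0 \<Longrightarrow> gauss_kernel \<sigma> (of_real a) t = of_real (normal_density a \<sigma> t)"
  by (simp add: gauss_kernel_def normal_density_def real_sqrt_mult exp_of_real[symmetric])

lemma borel_measurable_lognormal_density [measurable]: "lognormal_density \<mu> \<sigma> \<in> borel_measurable borel"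
  unfolding lognormal_density_def[abs_def] by measurable

lemma lognormal_density_nonneg: "\<sigma> > 0 \<Longrightarrow> lognormal_density \<mu> \<sigma> x \<ge> 0"
  by (simp add: lognormal_density_def)

text \<open>The Jacobian of \<open>x = exp s\<close> cancels the factor \<open>1 / x\<close> of the
  density.\<close>

lemma lognormal_density_exp:
  "\<sigma> > 0 \<Longrightarrow> lognormal_density \<mu> \<sigma> (exp s) * exp s = normal_density \<mu> \<sigma> s"
  by (simp add: lognormal_density_def normal_density_def real_sqrt_mult)

lemma isCont_lognormal_density:
  assumes "x > 0" "\<sigma> > 0"
  shows "isCont (lognormal_density \<mu> \<sigma>) x"
proof -
  have "isCont (\<lambda>x. 1 / (sqrt (2 * pi) * \<sigma> * x) * exp (- ((ln x - \<mu>)\<^sup>2) / (2 * \<sigma>\<^sup>2))) x"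
    using assms by (intro continuous_intros) auto
  moreover have eq: "\<forall>\<^sub>F y in nhds x. lognormal_density \<mu> \<sigma> y =
      1 / (sqrt (2 * pi) * \<sigma> * y) * exp (- ((ln y - \<mu>)\<^sup>2) / (2 * \<sigma>\<^sup>2))"
    using eventually_nhds_in_open[of "{0<..}" x] assms(1)
    by (auto simp: lognormal_density_def elim: eventually_mono)
  ultimately show ?thesis by (simp only: isCont_cong[OF eq])
qed

lemma laplace_transform_lognormal_eq:
  assumes \<sigma>: "\<sigma> > 0" and z: "Re z \<ge> 0"
  shows "laplace_transform (lognormal \<mu> \<sigma>) z =
    (\<integral>s. of_real (normal_density \<mu> \<sigma> s) * exp (- (z * of_real (exp s))) \<partial>lborel)"
proof -
  let ?d = "lognormal_density \<mu> \<sigma>"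
  let ?f = "\<lambda>x. ?d x *\<^sub>R exp (- (z * complex_of_real x))"
  have lim: "((ereal \<circ> exp \<circ> real_of_ereal) \<longlongrightarrow> 0) (at_right (- \<infinity>))"
    "((ereal \<circ> exp \<circ> real_of_ereal) \<longlongrightarrow> \<infinity>) (at_left \<infinity>)"
    using exp_at_bot exp_at_top by (simp_all add: ereal_tendsto_simps zero_ereal_def)
  \<comment> \<open>For a nonnegative integrand the substitution delivers integrability as a
    conclusion. It is needed as a hypothesis for the complex substitution further down, where
    \<open>?d\<close> is the majorant.\<close>
  have 1: "set_integrable lborel (einterval 0 \<infinity>) ?d"
  proof (rule interval_integral_substitution_nonneg(1)[OF _ _ _ _ _ _ lim])
    show "set_integrable lborel (einterval (- \<infinity>) \<infinity>) (\<lambda>x. ?d (exp x) * exp x)"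
      unfolding lognormal_density_exp[OF \<sigma>] set_integrable_def
      by (simp add: integrable_normal_density[OF \<sigma>])
  qed (auto intro: isCont_lognormal_density[OF _ \<sigma>] lognormal_density_nonneg[OF \<sigma>] DERIV_exp)
  have d_le: "norm (?f x) \<le> ?d x" for x
  proof (cases "x > 0")
    case True
    then have "norm (exp (- (z * complex_of_real x))) \<le> 1" using z by simp
    then show ?thesis using lognormal_density_nonneg[OF \<sigma>, of \<mu> x]
      by (simp only: norm_scaleR abs_of_nonneg mult_left_le)
  qed (simp add: lognormal_density_def)
  have 2: "set_integrable lborel (einterval 0 \<infinity>) ?f"
    using 1 unfolding set_integrable_def
    by (rule Bochner_Integration.integrable_bound)
      (use d_le lognormal_density_nonneg[OF \<sigma>] in \<open>auto simp: indicator_def intro!: always_eventually\<close>)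
  have "laplace_transform (lognormal \<mu> \<sigma>) z = (\<integral>x. ?f x \<partial>lborel)"
    unfolding laplace_transform_def lognormal_def
    by (rule integral_density) (auto simp: lognormal_density_nonneg[OF \<sigma>])
  \<comment> \<open>The density is 0 for \<open>x \<le> 0\<close>, so only the positive half-line
    counts.\<close>
  also have "\<dots> = (LBINT x=0..\<infinity>. ?f x)"
    unfolding interval_lebesgue_integral_def set_lebesgue_integral_def
    by (auto simp: einterval_def indicator_def lognormal_density_def zero_ereal_def intro!: Bochner_Integration.integral_cong)
  also have "\<dots> = (LBINT s=-\<infinity>..\<infinity>. exp s *\<^sub>R ?f (exp s))"
  proof (rule interval_integral_substitution_integrable[OF _ _ _ _ _ lim])
    have "integrable lborel (\<lambda>s. exp s *\<^sub>R ?f (exp s))"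
    proof (rule Bochner_Integration.integrable_bound[OF integrable_normal_density[OF \<sigma>, of \<mu>]])
      show "AE s in lborel. norm (exp s *\<^sub>R ?f (exp s)) \<le> norm (normal_density \<mu> \<sigma> s)"
      proof (rule always_eventually, rule allI)
        fix s
        have "norm (exp s *\<^sub>R ?f (exp s)) \<le> exp s * ?d (exp s)"
          unfolding norm_scaleR[of "exp s"] using d_le[of "exp s"] by (intro mult_mono) auto
        also have "\<dots> = normal_density \<mu> \<sigma> s"
          by (metis lognormal_density_exp[OF \<sigma>] mult.commute)
        finally show "norm (exp s *\<^sub>R ?f (exp s)) \<le> norm (normal_density \<mu> \<sigma> s)" by simp
      qed
    qed measurable
    then show "set_integrable lborel (einterval (- \<infinity>) \<infinity>) (\<lambda>s. exp s *\<^sub>R ?f (exp s))"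
      by (simp add: set_integrable_def)
    show "isCont ?f (exp s)" for s
      by (intro continuous_intros isCont_lognormal_density[OF _ \<sigma>]) simp
  qed (use 2 in \<open>auto intro: DERIV_exp\<close>)
  also have "\<dots> = (\<integral>s. exp s *\<^sub>R ?f (exp s) \<partial>lborel)"
    by (simp add: interval_lebesgue_integral_def set_lebesgue_integral_def)
  also have "\<dots> = (\<integral>s. of_real (normal_density \<mu> \<sigma> s) * exp (- (z * of_real (exp s))) \<partial>lborel)"
    by (rule Bochner_Integration.integral_cong)
      (simp_all add: scaleR_conv_of_real mult.commute flip: lognormal_density_exp[OF \<sigma>])
  finally show ?thesis .
qed

text \<open>In the right half-plane the exponential has modulus at most 1, so the normal density
  itself is a majorant; any radius would do.\<close>

lemma holomorphic_laplace_transform_lognormal: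
  assumes \<sigma>: "\<sigma> > 0"
  shows "laplace_transform (lognormal \<mu> \<sigma>) holomorphic_on {z. Re z > 0}"
proof -
  have "(\<lambda>z. \<integral>s. of_real (normal_density \<mu> \<sigma> s) * exp (- (z * of_real (exp s))) \<partial>lborel)
      holomorphic_on {z. Re z > 0}"
  proof (rule holomorphic_on_lebesgue_integral)
    show "\<exists>r g. r > 0 \<and> integrable lborel g \<and> (\<forall>w\<in>ball z r \<inter> {z. Re z > 0}. \<forall>t.
        norm (of_real (normal_density \<mu> \<sigma> t) * exp (- (w * complex_of_real (exp t)))) \<le> g t)" for z
      using \<sigma> by (intro exI[of _ 1] exI[of _ "normal_density \<mu> \<sigma>"])
        (auto simp: norm_mult intro!: mult_left_le)
  qed (auto simp: open_halfspace_Re_gt intro!: holomorphic_intros)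
  then show ?thesis
    by (rule holomorphic_transform) (simp add: laplace_transform_lognormal_eq[OF \<sigma>])
qed

text \<open>For positive \<open>r\<close> the factor in \<open>r * exp s = exp (s + ln r)\<close> is
  absorbed by a real translation \<open>t = s + ln r\<close>. Complex arguments are reached later by
  the identity theorem.\<close>

lemma laplace_transform_lognormal_of_real:
  assumes \<sigma>: "\<sigma> > 0" and r: "r > 0"
  shows "laplace_transform (lognormal \<mu> \<sigma>) (of_real r) = lognormal_phi_integral \<sigma> (of_real (\<mu> + ln r))"
proof -
  have nd: "normal_density \<mu> \<sigma> (t - ln r) = normal_density (\<mu> + ln r) \<sigma> t" for t
    by (simp add: normal_density_def algebra_simps)
  have er: "r * exp (t - ln r) = exp t" for t using r by (simp add: exp_diff)
  have "laplace_transform (lognormal \<mu> \<sigma>) (of_real r) =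
    (\<integral>s. of_real (normal_density \<mu> \<sigma> s) * exp (- (of_real r * of_real (exp s))) \<partial>lborel)"
    using r by (intro laplace_transform_lognormal_eq[OF \<sigma>]) simp
  also have "\<dots> = (\<integral>t. of_real (normal_density \<mu> \<sigma> (- ln r + 1 * t)) *
      exp (- (of_real r * of_real (exp (- ln r + 1 * t)))) \<partial>lborel)"
    by (subst lborel_integral_real_affine[of 1 _ "- ln r"]) simp_all
  also have "\<dots> = (\<integral>t. of_real (exp (- exp t)) * gauss_kernel \<sigma> (of_real (\<mu> + ln r)) t \<partial>lborel)"
  proof (rule Bochner_Integration.integral_cong[OF refl])
    fix t
    have "- ln r + 1 * t = t - ln r" by simp
    then show "of_real (normal_density \<mu> \<sigma> (- ln r + 1 * t)) *
      exp (- (of_real r * of_real (exp (- ln r + 1 * t)))) =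
      of_real (exp (- exp t)) * gauss_kernel \<sigma> (of_real (\<mu> + ln r)) t"
      unfolding gauss_kernel_of_real[OF \<sigma>] of_real_mult[symmetric]
      by (simp only: nd er exp_of_real of_real_minus[symmetric] mult.commute) (simp only: of_real_mult)
  qed
  finally show ?thesis by (simp only: lognormal_phi_integral_def)
qed

lemma connected_slit_plane: "connected (- \<real>\<^sub>\<le>\<^sub>0 :: complex set)"
proof -
  have "(\<real>\<^sub>\<le>\<^sub>0 :: complex set) = of_real ` {..0}" by (auto simp: nonpos_Reals_def)
  then show ?thesis
    using starlike_imp_connected[OF starlike_slotted_complex_plane_left[of 0]] by simp
qed

text \<open>The identity theorem is used twice. On the right half-plane it extends the agreement of
  \<open>?F\<close> with the transform from the positive reals, so \<open>?F\<close> witnesses the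
  choice in \<open>lognormal_phi\<close>; on the connected slit plane it then forces the chosen
  function to be \<open>?F\<close>.\<close>

lemma lognormal_phi_eq:
  assumes \<sigma>: "\<sigma> > 0" and z: "z \<notin> \<real>\<^sub>\<le>\<^sub>0"
  shows "lognormal_phi \<mu> \<sigma> z = lognormal_phi_integral \<sigma> (of_real \<mu> + Ln z)"
proof -
  let ?F = "\<lambda>z. lognormal_phi_integral \<sigma> (of_real \<mu> + Ln z)"
  let ?L = "laplace_transform (lognormal \<mu> \<sigma>)"
  let ?H = "{z. Re z > 0}"
  let ?P = "\<lambda>f. f holomorphic_on (- \<real>\<^sub>\<le>\<^sub>0) \<and> (\<forall>z. Re z > 0 \<longrightarrow> f z = ?L z)"
  have H: "?H \<subseteq> - \<real>\<^sub>\<le>\<^sub>0" by (auto simp: complex_nonpos_Reals_iff)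
  have F: "?F holomorphic_on (- \<real>\<^sub>\<le>\<^sub>0)"
  proof -
    have "(\<lambda>z. of_real \<mu> + Ln z) holomorphic_on (- \<real>\<^sub>\<le>\<^sub>0)"
      by (intro holomorphic_intros) auto
    from holomorphic_on_compose_gen[OF this holomorphic_lognormal_phi_integral[OF \<sigma>] subset_UNIV]
    show ?thesis by (simp only: o_def)
  qed
  \<comment> \<open>The identity theorem needs an accumulation point of the set of agreement inside
    the domain; 1 serves for both domains.\<close>
  have lim1: "(1::complex) islimpt of_real ` {0<..}"
    unfolding islimpt_approachable
  proof (intro allI impI)
    fix e :: real assume "e > 0"
    then show "\<exists>x'\<in>complex_of_real ` {0<..}. x' \<noteq> 1 \<and> dist x' 1 < e"
      by (intro bexI[of _ "of_real (1 + e / 2)"] imageI) (auto simp: dist_norm)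
  qed
  have FL: "?F w = ?L w" if w: "Re w > 0" for w
  proof -
    have "?F w - ?L w = 0"
    proof (rule analytic_continuation[of "\<lambda>z. ?F z - ?L z" ?H "of_real ` {0<..}" 1])
      show "(\<lambda>z. ?F z - ?L z) holomorphic_on ?H"
        by (intro holomorphic_on_diff holomorphic_on_subset[OF F H] holomorphic_laplace_transform_lognormal[OF \<sigma>])
      show "connected ?H" by (intro convex_connected convex_halfspace_Re_gt)
      show "?F v - ?L v = 0" if "v \<in> of_real ` {0<..}" for v
        using that by (auto simp: laplace_transform_lognormal_of_real[OF \<sigma>] Ln_of_real)
    qed (use w lim1 in \<open>auto simp: open_halfspace_Re_gt\<close>)
    then show ?thesis by simp
  qed
  have P: "?P (lognormal_phi \<mu> \<sigma>)"
    unfolding lognormal_phi_def by (rule someI[of ?P ?F]) (use F FL in blast)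
  have "lognormal_phi \<mu> \<sigma> z - ?F z = 0"
  proof (rule analytic_continuation[of "\<lambda>z. lognormal_phi \<mu> \<sigma> z - ?F z" "- \<real>\<^sub>\<le>\<^sub>0" "of_real ` {0<..}" 1])
    show "(\<lambda>z. lognormal_phi \<mu> \<sigma> z - ?F z) holomorphic_on - \<real>\<^sub>\<le>\<^sub>0"
      using P F by (intro holomorphic_on_diff) auto
    show "lognormal_phi \<mu> \<sigma> v - ?F v = 0" if "v \<in> of_real ` {0<..}" for v
      using that P FL by auto
    show "complex_of_real ` {0<..} \<subseteq> - \<real>\<^sub>\<le>\<^sub>0" using H by auto
  qed (use z lim1 connected_slit_plane closed_nonpos_Reals_complex in auto)
  then show ?thesis by simp
qed

section \<open>Convergence, uniform error and the limit at the origin\<close>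

theorem theorem3:
  fixes \<mu> \<sigma> :: real
  assumes "\<sigma> > 0"
  shows "(\<forall>\<alpha>\<ge>1. \<forall>z. z \<notin> \<real>\<^sub>\<le>\<^sub>0 \<longrightarrow> summable (S_term \<mu> \<sigma> \<alpha> z)) \<and>
    (\<exists>C. \<forall>\<alpha>\<ge>1. \<forall>z. z \<notin> \<real>\<^sub>\<le>\<^sub>0 \<longrightarrow>
       cmod (lognormal_phi \<mu> \<sigma> z - S \<mu> \<sigma> \<alpha> z) \<le> C * exp (- \<alpha>)) \<and>
    (\<forall>\<alpha>\<ge>1. ((\<lambda>z. lognormal_phi \<mu> \<sigma> z / S \<mu> \<sigma> \<alpha> z) \<longlongrightarrow> 1) (at 0 within (- \<real>\<^sub>\<le>\<^sub>0)))"
proof -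
  note \<sigma> = assms
  define w where "w z = complex_of_real \<mu> + Ln z" for z
  define R where "R \<alpha> z =
    (\<integral>t. indicator {ln \<alpha>..} t * of_real (exp (- exp t)) * gauss_kernel \<sigma> (w z) t \<partial>lborel)" for \<alpha> z
  \<comment> \<open>\<open>Im (w z)\<close> is the principal argument of \<open>z\<close>, at most
    \<open>pi\<close> in modulus, so \<open>K\<close> bounds the mass of the modulus of the kernel
    uniformly in \<open>z\<close>. In \<open>E\<close> the factor \<open>exp \<mu>\<close> comes
    from \<open>exp (Re (w z)) = exp \<mu> * norm z\<close>.\<close>
  define K where "K = exp (pi\<^sup>2 / (2 * \<sigma>\<^sup>2))"
  define E where "E = K * exp (\<mu> + \<sigma>\<^sup>2 / 2)"
  have ImK: "exp ((Im (w z))\<^sup>2 / (2 * \<sigma>\<^sup>2)) \<le> K" if "z \<notin> \<real>\<^sub>\<le>\<^sub>0" for z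
  proof -
    have "z \<noteq> 0" using that by auto
    then have "\<bar>Im (w z)\<bar> \<le> \<bar>pi\<bar>"
      using mpi_less_Im_Ln[of z] Im_Ln_le_pi[of z] by (simp add: w_def)
    then have "(Im (w z))\<^sup>2 \<le> pi\<^sup>2" by (simp only: abs_le_square_iff)
    then show ?thesis by (simp add: K_def divide_right_mono)
  qed
  have E: "exp ((Im (w z))\<^sup>2 / (2 * \<sigma>\<^sup>2)) * exp (Re (w z) + \<sigma>\<^sup>2 / 2) \<le> E * norm z"
    if z: "z \<notin> \<real>\<^sub>\<le>\<^sub>0" for z
  proof -
    have "z \<noteq> 0" using z by auto
    then have "exp (Re (w z) + \<sigma>\<^sup>2 / 2) = exp (\<mu> + \<sigma>\<^sup>2 / 2) * norm z"
      by (simp add: w_def exp_add)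
    then show ?thesis unfolding E_def using ImK[OF z] by (simp add: mult.assoc mult_right_mono)
  qed
  have sums: "S_term \<mu> \<sigma> \<alpha> z sums (lognormal_phi \<mu> \<sigma> z - R \<alpha> z)"
    if "\<alpha> \<ge> 1" "z \<notin> \<real>\<^sub>\<le>\<^sub>0" for \<alpha> z
  proof -
    have "\<alpha> > 0" "z \<noteq> 0" using that by auto
    from S_term_sums[OF \<sigma> this] show ?thesis
      unfolding lognormal_phi_eq[OF \<sigma> that(2)] lognormal_phi_integral_split[OF \<sigma>, where c = "ln \<alpha>"]
        R_def w_def by simp
  qed
  have S: "S \<mu> \<sigma> \<alpha> z = lognormal_phi \<mu> \<sigma> z - R \<alpha> z" if "\<alpha> \<ge> 1" "z \<notin> \<real>\<^sub>\<le>\<^sub>0" for \<alpha> z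
    unfolding S_def using sums[OF that] by (rule sums_unique[symmetric])
  have "cmod (lognormal_phi \<mu> \<sigma> z - S \<mu> \<sigma> \<alpha> z) \<le> K * exp (- \<alpha>)" if "\<alpha> \<ge> 1" "z \<notin> \<real>\<^sub>\<le>\<^sub>0" for \<alpha> z
  proof -
    have "cmod (R \<alpha> z) \<le> exp (- \<alpha>) * exp ((Im (w z))\<^sup>2 / (2 * \<sigma>\<^sup>2))"
      unfolding R_def by (rule upper_tail_le(1)[OF \<sigma> that(1)])
    also have "\<dots> \<le> exp (- \<alpha>) * K" by (intro mult_left_mono ImK that) simp
    finally show ?thesis by (simp add: S[OF that] mult.commute)
  qed
  moreover have "((\<lambda>z. lognormal_phi \<mu> \<sigma> z / S \<mu> \<sigma> \<alpha> z) \<longlongrightarrow> 1) (at 0 within (- \<real>\<^sub>\<le>\<^sub>0))"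
    if \<alpha>: "\<alpha> \<ge> 1" for \<alpha>
  proof -
    let ?A = "at 0 within (- \<real>\<^sub>\<le>\<^sub>0 :: complex set)"
    have slit: "\<forall>\<^sub>F z in ?A. z \<notin> \<real>\<^sub>\<le>\<^sub>0" by (auto simp: eventually_at_filter)
    have E0: "((\<lambda>z. E * norm z) \<longlongrightarrow> 0) ?A"
      by (intro tendsto_mult_right_zero tendsto_norm_zero tendsto_ident_at)
    have "((\<lambda>z. lognormal_phi \<mu> \<sigma> z - 1) \<longlongrightarrow> 0) ?A"
    proof (rule Lim_null_comparison[OF _ E0])
      show "\<forall>\<^sub>F z in ?A. norm (lognormal_phi \<mu> \<sigma> z - 1) \<le> E * norm z"
        using slit
      proof eventually_elim
        case (elim z)
        then show ?case
          using order_trans[OF lognormal_phi_integral_minus_1[OF \<sigma>] E[OF elim]]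
          by (simp add: lognormal_phi_eq[OF \<sigma>] w_def)
      qed
    qed
    then have phi: "(lognormal_phi \<mu> \<sigma> \<longlongrightarrow> 1) ?A" by (simp add: LIM_zero_iff)
    have R0: "(R \<alpha> \<longlongrightarrow> 0) ?A"
    proof (rule Lim_null_comparison[OF _ E0])
      show "\<forall>\<^sub>F z in ?A. norm (R \<alpha> z) \<le> E * norm z"
        using slit
      proof eventually_elim
        case (elim z)
        then show ?case
          using order_trans[OF upper_tail_le(2)[OF \<sigma> \<alpha>] E[OF elim]] by (simp add: R_def)
      qed
    qed
    \<comment> \<open>The denominator tends to \<open>1 - 0\<close>, so the quotient converges. It
      agrees with the quotient by \<open>S\<close> only off the slit, which is enough within the
      filter.\<close>
    have "((\<lambda>z. lognormal_phi \<mu> \<sigma> z / (lognormal_phi \<mu> \<sigma> z - R \<alpha> z)) \<longlongrightarrow> 1 / (1 - 0)) ?A"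
      by (intro tendsto_intros phi R0) simp
    moreover have "\<forall>\<^sub>F z in ?A. lognormal_phi \<mu> \<sigma> z / (lognormal_phi \<mu> \<sigma> z - R \<alpha> z)
        = lognormal_phi \<mu> \<sigma> z / S \<mu> \<sigma> \<alpha> z"
      using slit by eventually_elim (simp add: S[OF \<alpha>])
    ultimately show ?thesis by (simp add: Lim_transform_eventually)
  qed
  ultimately show ?thesis using sums by (meson sums_summable)
qed

end
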